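(* Let $M$ and $N$ be objects of an abelian category $\mathcal{A}$, $M'$ a direct summand of $M$ and $N'$ a direct summand of $N$. The following hold both with all words in parentheses omitted and with all of them included. (1) Assume that $\mathcal{A}$ is AB3*. If $N$ is (strongly) $M$-CS-Baer, then $N'$ is (strongly) $M'$-CS-Baer. (2) Assume that $\mathcal{A}$ is AB3. If $N$ is dual (strongly) $M$-CS-Baer, then $N'$ is dual (strongly) $M'$-CS-Baer.
   Context: An abelian category is AB3 (AB3* ) if it has arbitrary coproducts (products); it then has arbitrary sums (intersections) of families of subobjects. A subobject $i:K\to M$ is fully invariant if for every $h:M\to M$ one has $hi=i\alpha$ for some $\alpha:K\to K$. A subobject $L$ of $N$ lies above a direct summand $K$ of $N$ if $K\subseteq L$ and $L/K$ is superfluous in $N/K$ (a subobject $A$ of $B$ is superfluous if $A+X=B$ implies $X=B$ for every subobject $X$ of $B$). In an AB3* abelian category, $N$ is (strongly) $M$-CS-Baer if for every family $(f_i)_{i\in I}$ of morphisms $f_i:M\to N$, $\bigcap_{i\in I}\mathrm{Ker}(f_i)$ is essential in a (fully invariant) direct summand of $M$. In an AB3 abelian category, $N$ is dual (strongly) $M$-CS-Baer if for every family $(f_i)_{i\in I}$ of morphisms $f_i:M\to N$, $\sum_{i\in I}\mathrm{Im}(f_i)$ lies above a (fully invariant) direct summand of $N$. *)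

theory Defs
  imports "HOL-Algebra.Group"
begin

section \<open>Abelian categories\<close>

record ('o, 'a) cat =
  Ob :: "'o set"
  Ar :: "'a set"
  Dom :: "'a \<Rightarrow> 'o"
  Cod :: "'a \<Rightarrow> 'o"
  ide :: "'o \<Rightarrow> 'a"
  cmp :: "'a \<Rightarrow> 'a \<Rightarrow> 'a"  (infixl \<open>\<cdot>\<index>\<close> 70)
  hadd :: "'a \<Rightarrow> 'a \<Rightarrow> 'a"
  hzero :: "'o \<Rightarrow> 'o \<Rightarrow> 'a"

definition homset :: "('o, 'a) cat \<Rightarrow> 'o \<Rightarrow> 'o \<Rightarrow> 'a set" where
  "homset C A B = {f \<in> Ar C. Dom C f = A \<and> Cod C f = B}"

locale category =
  fixes C :: "('o, 'a) cat" (structure)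
  assumes dom_closed: "f \<in> Ar C \<Longrightarrow> Dom C f \<in> Ob C"
    and cod_closed: "f \<in> Ar C \<Longrightarrow> Cod C f \<in> Ob C"
    and ide_closed: "A \<in> Ob C \<Longrightarrow> ide C A \<in> homset C A A"
    and cmp_closed: "f \<in> homset C A B \<Longrightarrow> g \<in> homset C B D \<Longrightarrow> g \<cdot> f \<in> homset C A D"
    and cmp_ide: "f \<in> homset C A B \<Longrightarrow> f \<cdot> ide C A = f"
    and ide_cmp: "f \<in> homset C A B \<Longrightarrow> ide C B \<cdot> f = f"
    and cmp_assoc: "f \<in> homset C A B \<Longrightarrow> g \<in> homset C B D \<Longrightarrow> h \<in> homset C D E
      \<Longrightarrow> h \<cdot> g \<cdot> f = h \<cdot> (g \<cdot> f)"

locale preadditive_category = category +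
  assumes hom_group: "A \<in> Ob C \<Longrightarrow> B \<in> Ob C
      \<Longrightarrow> comm_group \<lparr>carrier = homset C A B, mult = hadd C, one = hzero C A B\<rparr>"
    and cmp_hadd_right: "f \<in> homset C A B \<Longrightarrow> f' \<in> homset C A B \<Longrightarrow> g \<in> homset C B D
      \<Longrightarrow> g \<cdot> hadd C f f' = hadd C (g \<cdot> f) (g \<cdot> f')"
    and cmp_hadd_left: "f \<in> homset C A B \<Longrightarrow> g \<in> homset C B D \<Longrightarrow> g' \<in> homset C B D
      \<Longrightarrow> hadd C g g' \<cdot> f = hadd C (g \<cdot> f) (g' \<cdot> f)"

definition zero_object :: "('o, 'a) cat \<Rightarrow> 'o \<Rightarrow> bool" where
  "zero_object C Z \<longleftrightarrow> Z \<in> Ob C \<and>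
    (\<forall>A\<in>Ob C. (\<exists>!f. f \<in> homset C Z A) \<and> (\<exists>!f. f \<in> homset C A Z))"

definition monic :: "('o, 'a) cat \<Rightarrow> 'a \<Rightarrow> bool" where
  "monic C f \<longleftrightarrow> f \<in> Ar C \<and>
    (\<forall>T. \<forall>g\<in>homset C T (Dom C f). \<forall>h\<in>homset C T (Dom C f).
      f \<cdot>\<^bsub>C\<^esub> g = f \<cdot>\<^bsub>C\<^esub> h \<longrightarrow> g = h)"

definition epic :: "('o, 'a) cat \<Rightarrow> 'a \<Rightarrow> bool" where
  "epic C f \<longleftrightarrow> f \<in> Ar C \<and>
    (\<forall>T. \<forall>g\<in>homset C (Cod C f) T. \<forall>h\<in>homset C (Cod C f) T.
      g \<cdot>\<^bsub>C\<^esub> f = h \<cdot>\<^bsub>C\<^esub> f \<longrightarrow> g = h)"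

definition is_kernel :: "('o, 'a) cat \<Rightarrow> 'a \<Rightarrow> 'a \<Rightarrow> bool" where
  "is_kernel C k f \<longleftrightarrow> f \<in> Ar C \<and> k \<in> homset C (Dom C k) (Dom C f) \<and>
    f \<cdot>\<^bsub>C\<^esub> k = hzero C (Dom C k) (Cod C f) \<and>
    (\<forall>T. \<forall>g\<in>homset C T (Dom C f). f \<cdot>\<^bsub>C\<^esub> g = hzero C T (Cod C f) \<longrightarrow>
      (\<exists>!h. h \<in> homset C T (Dom C k) \<and> k \<cdot>\<^bsub>C\<^esub> h = g))"

definition is_cokernel :: "('o, 'a) cat \<Rightarrow> 'a \<Rightarrow> 'a \<Rightarrow> bool" where
  "is_cokernel C q f \<longleftrightarrow> f \<in> Ar C \<and> q \<in> homset C (Cod C f) (Cod C q) \<and>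
    q \<cdot>\<^bsub>C\<^esub> f = hzero C (Dom C f) (Cod C q) \<and>
    (\<forall>T. \<forall>g\<in>homset C (Cod C f) T. g \<cdot>\<^bsub>C\<^esub> f = hzero C (Dom C f) T \<longrightarrow>
      (\<exists>!h. h \<in> homset C (Cod C q) T \<and> h \<cdot>\<^bsub>C\<^esub> q = g))"

definition is_biproduct ::
    "('o, 'a) cat \<Rightarrow> 'o \<Rightarrow> 'o \<Rightarrow> 'o \<Rightarrow> 'a \<Rightarrow> 'a \<Rightarrow> 'a \<Rightarrow> 'a \<Rightarrow> bool" where
  "is_biproduct C X A B i j p q \<longleftrightarrow>
    i \<in> homset C A X \<and> j \<in> homset C B X \<and> p \<in> homset C X A \<and> q \<in> homset C X B \<and>
    p \<cdot>\<^bsub>C\<^esub> i = ide C A \<and> q \<cdot>\<^bsub>C\<^esub> j = ide C B \<and>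
    p \<cdot>\<^bsub>C\<^esub> j = hzero C B A \<and> q \<cdot>\<^bsub>C\<^esub> i = hzero C A B \<and>
    hadd C (i \<cdot>\<^bsub>C\<^esub> p) (j \<cdot>\<^bsub>C\<^esub> q) = ide C X"

locale abelian_category = preadditive_category +
  assumes ex_zero_object: "\<exists>Z. zero_object C Z"
    and ex_biproduct: "A \<in> Ob C \<Longrightarrow> B \<in> Ob C \<Longrightarrow> \<exists>X i j p q. is_biproduct C X A B i j p q"
    and ex_kernel: "f \<in> Ar C \<Longrightarrow> \<exists>k. is_kernel C k f"
    and ex_cokernel: "f \<in> Ar C \<Longrightarrow> \<exists>q. is_cokernel C q f"
    and monic_normal: "monic C m \<Longrightarrow> \<exists>f. is_kernel C m f"
    and epic_normal: "epic C e \<Longrightarrow> \<exists>f. is_cokernel C e f"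

text \<open>HOL cannot quantify over index types inside a formula, so the index sets of ``arbitrary''
  families are the subsets of a type \<open>'i\<close> that is passed as a parameter. Nothing relates \<open>'i\<close> to the
  type of arrows: a category with products indexed by a set at least as large as its set of arrows
  has at most one arrow between any two objects.\<close>

definition is_product :: "('o, 'a) cat \<Rightarrow> 'i set \<Rightarrow> ('i \<Rightarrow> 'o) \<Rightarrow> 'o \<Rightarrow> ('i \<Rightarrow> 'a) \<Rightarrow> bool" where
  "is_product C I X P p \<longleftrightarrow> P \<in> Ob C \<and> (\<forall>i\<in>I. p i \<in> homset C P (X i)) \<and>
    (\<forall>T\<in>Ob C. \<forall>g. (\<forall>i\<in>I. g i \<in> homset C T (X i)) \<longrightarrow>
      (\<exists>!h. h \<in> homset C T P \<and> (\<forall>i\<in>I. p i \<cdot>\<^bsub>C\<^esub> h = g i)))"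

definition is_coproduct :: "('o, 'a) cat \<Rightarrow> 'i set \<Rightarrow> ('i \<Rightarrow> 'o) \<Rightarrow> 'o \<Rightarrow> ('i \<Rightarrow> 'a) \<Rightarrow> bool" where
  "is_coproduct C I X P u \<longleftrightarrow> P \<in> Ob C \<and> (\<forall>i\<in>I. u i \<in> homset C (X i) P) \<and>
    (\<forall>T\<in>Ob C. \<forall>g. (\<forall>i\<in>I. g i \<in> homset C (X i) T) \<longrightarrow>
      (\<exists>!h. h \<in> homset C P T \<and> (\<forall>i\<in>I. h \<cdot>\<^bsub>C\<^esub> u i = g i)))"

definition AB3 :: "'i itself \<Rightarrow> ('o, 'a) cat \<Rightarrow> bool" where
  "AB3 ty C \<longleftrightarrow> abelian_category C \<and>
    (\<forall>(I::'i set) X. (\<forall>i\<in>I. X i \<in> Ob C) \<longrightarrow> (\<exists>P u. is_coproduct C I X P u))"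

definition AB3_star :: "'i itself \<Rightarrow> ('o, 'a) cat \<Rightarrow> bool" where
  "AB3_star ty C \<longleftrightarrow> abelian_category C \<and>
    (\<forall>(I::'i set) X. (\<forall>i\<in>I. X i \<in> Ob C) \<longrightarrow> (\<exists>P p. is_product C I X P p))"


section \<open>Subobjects\<close>

text \<open>A subobject is represented by a monomorphism. Two of them are the same subobject if each
  factors through the other, which is the equivalence \<open>eq\<close> of the order structure below;
  intersections and sums of subobjects are its infima and suprema.\<close>

definition subobject :: "('o, 'a) cat \<Rightarrow> 'a \<Rightarrow> 'o \<Rightarrow> bool" where
  "subobject C m X \<longleftrightarrow> monic C m \<and> Cod C m = X"

definition sub_le :: "('o, 'a) cat \<Rightarrow> 'a \<Rightarrow> 'a \<Rightarrow> bool" where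
  "sub_le C m n \<longleftrightarrow> (\<exists>h\<in>homset C (Dom C m) (Dom C n). n \<cdot>\<^bsub>C\<^esub> h = m)"

definition subobjects :: "('o, 'a) cat \<Rightarrow> 'o \<Rightarrow> 'a gorder" where
  "subobjects C X = \<lparr>carrier = {m. subobject C m X},
    eq = (\<lambda>m n. sub_le C m n \<and> sub_le C n m), le = sub_le C\<rparr>"

definition is_image :: "('o, 'a) cat \<Rightarrow> 'a \<Rightarrow> 'a \<Rightarrow> bool" where
  "is_image C m f \<longleftrightarrow> (\<exists>q. is_cokernel C q f \<and> is_kernel C m q)"

text \<open>The families \<open>Ker (f i)\<close> and \<open>Im (f i)\<close> are given by the sets of all their representing
  monomorphisms, so that no representative has to be chosen.\<close>

definition is_inter_kernels :: "('o, 'a) cat \<Rightarrow> 'o \<Rightarrow> 'i set \<Rightarrow> ('i \<Rightarrow> 'a) \<Rightarrow> 'a \<Rightarrow> bool" where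
  "is_inter_kernels C M I f l \<longleftrightarrow>
    is_glb (subobjects C M) l {k. \<exists>i\<in>I. is_kernel C k (f i)}"

definition is_sum_images :: "('o, 'a) cat \<Rightarrow> 'o \<Rightarrow> 'i set \<Rightarrow> ('i \<Rightarrow> 'a) \<Rightarrow> 'a \<Rightarrow> bool" where
  "is_sum_images C N I f l \<longleftrightarrow>
    is_lub (subobjects C N) l {m. \<exists>i\<in>I. is_image C m (f i)}"

definition direct_summand :: "('o, 'a) cat \<Rightarrow> 'a \<Rightarrow> 'o \<Rightarrow> bool" where
  "direct_summand C k X \<longleftrightarrow> (\<exists>B j p q. is_biproduct C X (Dom C k) B k j p q)"

definition fully_invariant :: "('o, 'a) cat \<Rightarrow> 'a \<Rightarrow> 'o \<Rightarrow> bool" where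
  "fully_invariant C k X \<longleftrightarrow> subobject C k X \<and>
    (\<forall>h\<in>homset C X X. \<exists>\<alpha>\<in>homset C (Dom C k) (Dom C k). h \<cdot>\<^bsub>C\<^esub> k = k \<cdot>\<^bsub>C\<^esub> \<alpha>)"

definition essential :: "('o, 'a) cat \<Rightarrow> 'a \<Rightarrow> 'o \<Rightarrow> bool" where
  "essential C a B \<longleftrightarrow> subobject C a B \<and>
    (\<forall>x z. subobject C x B \<and> is_glb (subobjects C B) z {a, x} \<and> zero_object C (Dom C z)
      \<longrightarrow> zero_object C (Dom C x))"

definition superfluous :: "('o, 'a) cat \<Rightarrow> 'a \<Rightarrow> 'o \<Rightarrow> bool" where
  "superfluous C a B \<longleftrightarrow> subobject C a B \<and>
    (\<forall>x. subobject C x B \<and> is_lub (subobjects C B) (ide C B) {a, x}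
      \<longrightarrow> x .=\<^bsub>subobjects C B\<^esub> ide C B)"

definition essential_in :: "('o, 'a) cat \<Rightarrow> 'a \<Rightarrow> 'a \<Rightarrow> bool" where
  "essential_in C l k \<longleftrightarrow> (\<exists>e. essential C e (Dom C k) \<and> l = k \<cdot>\<^bsub>C\<^esub> e)"

text \<open>In \<open>lies_above\<close>, \<open>e\<close> is the inclusion of \<open>K\<close> in \<open>L\<close>, \<open>q\<close> and \<open>p\<close> are the projections onto
  \<open>L/K\<close> and \<open>N/K\<close>, and \<open>s\<close> is the induced morphism from \<open>L/K\<close> to \<open>N/K\<close>.\<close>

definition lies_above :: "('o, 'a) cat \<Rightarrow> 'a \<Rightarrow> 'a \<Rightarrow> bool" where
  "lies_above C l k \<longleftrightarrow> (\<exists>e\<in>homset C (Dom C k) (Dom C l). l \<cdot>\<^bsub>C\<^esub> e = k \<and>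
    (\<exists>q p. is_cokernel C q e \<and> is_cokernel C p k \<and>
      (\<exists>s\<in>homset C (Cod C q) (Cod C p). s \<cdot>\<^bsub>C\<^esub> q = p \<cdot>\<^bsub>C\<^esub> l \<and> superfluous C s (Cod C p))))"


section \<open>CS-Baer objects\<close>

text \<open>In each case the second object argument is \<open>N\<close>: \<open>cs_baer TYPE('i) C M N\<close> says that \<open>N\<close> is
  \<open>M\<close>-CS-Baer.\<close>

definition cs_baer :: "'i itself \<Rightarrow> ('o, 'a) cat \<Rightarrow> 'o \<Rightarrow> 'o \<Rightarrow> bool" where
  "cs_baer ty C M N \<longleftrightarrow>
    (\<forall>(I::'i set) f. (\<forall>i\<in>I. f i \<in> homset C M N) \<longrightarrow>
      (\<exists>l k. is_inter_kernels C M I f l \<and> direct_summand C k M \<and> essential_in C l k))"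

definition strongly_cs_baer :: "'i itself \<Rightarrow> ('o, 'a) cat \<Rightarrow> 'o \<Rightarrow> 'o \<Rightarrow> bool" where
  "strongly_cs_baer ty C M N \<longleftrightarrow>
    (\<forall>(I::'i set) f. (\<forall>i\<in>I. f i \<in> homset C M N) \<longrightarrow>
      (\<exists>l k. is_inter_kernels C M I f l \<and> direct_summand C k M \<and> fully_invariant C k M \<and>
        essential_in C l k))"

definition dual_cs_baer :: "'i itself \<Rightarrow> ('o, 'a) cat \<Rightarrow> 'o \<Rightarrow> 'o \<Rightarrow> bool" where
  "dual_cs_baer ty C M N \<longleftrightarrow>
    (\<forall>(I::'i set) f. (\<forall>i\<in>I. f i \<in> homset C M N) \<longrightarrow>
      (\<exists>l k. is_sum_images C N I f l \<and> direct_summand C k N \<and> lies_above C l k))"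

definition dual_strongly_cs_baer :: "'i itself \<Rightarrow> ('o, 'a) cat \<Rightarrow> 'o \<Rightarrow> 'o \<Rightarrow> bool" where
  "dual_strongly_cs_baer ty C M N \<longleftrightarrow>
    (\<forall>(I::'i set) f. (\<forall>i\<in>I. f i \<in> homset C M N) \<longrightarrow>
      (\<exists>l k. is_sum_images C N I f l \<and> direct_summand C k N \<and> fully_invariant C k N \<and>
        lies_above C l k))"

end

theory Submission
  imports Defs
begin

text \<open>
  Write \<open>M = M' \<oplus> B\<close> with projection \<open>p\<close> and extend a family \<open>f i\<close> from \<open>M'\<close> to \<open>N'\<close> to the family
  \<open>n \<cdot> f i \<cdot> p\<close> from \<open>M\<close> to \<open>N\<close>, with the same index set.

  The intersection \<open>L\<close> of the kernels of the extended family contains \<open>B\<close> and meets \<open>M'\<close> in the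
  intersection \<open>L'\<close> of the kernels of the \<open>f i\<close>. If \<open>L\<close> is essential in a direct summand \<open>K\<close> of \<open>M\<close>,
  then \<open>K\<close> contains \<open>B\<close>, so \<open>K = (K \<inter> M') \<oplus> B\<close> and \<open>K \<inter> M'\<close> is a direct summand of \<open>M'\<close>, in which
  \<open>L'\<close> is essential.

  The sum of the images of the extended family is the sum \<open>L\<close> of the images of the \<open>f i\<close>, seen as a
  subobject of \<open>N\<close>. A direct summand \<open>K\<close> of \<open>N\<close> below \<open>L\<close> is a direct summand of \<open>N'\<close>, and \<open>N'/K\<close> is
  a direct summand of \<open>N/K\<close>, so \<open>L/K\<close> remains superfluous in it. In both cases an endomorphism of the
  direct summand extends by zero to the whole object, which gives full invariance.
\<close>

section \<open>Composition, kernels and the order of subobjects\<close>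

context category
begin

lemma homset_iff: "f \<in> homset C A B \<longleftrightarrow> f \<in> Ar C \<and> Dom C f = A \<and> Cod C f = B"
  by (simp add: homset_def)

lemma cmp_typing [simp]:
  assumes "f \<in> Ar C" "g \<in> Ar C" "Cod C f = Dom C g"
  shows "g \<cdot> f \<in> Ar C" "Dom C (g \<cdot> f) = Dom C f" "Cod C (g \<cdot> f) = Cod C g"
  using cmp_closed[of f "Dom C f" "Dom C g" g "Cod C g"] assms by (auto simp: homset_iff)

lemma assoc [simp]:
  assumes "f \<in> Ar C" "g \<in> Ar C" "h \<in> Ar C" "Cod C f = Dom C g" "Cod C g = Dom C h"
  shows "h \<cdot> g \<cdot> f = h \<cdot> (g \<cdot> f)"
  using cmp_assoc[of f "Dom C f" "Dom C g" g "Dom C h" h "Cod C h"] assms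
  by (auto simp: homset_iff)

lemma ide_typing [simp]:
  assumes "A \<in> Ob C"
  shows "ide C A \<in> Ar C" "Dom C (ide C A) = A" "Cod C (ide C A) = A"
  using ide_closed[OF assms] by (auto simp: homset_iff)

lemma cmp_ide_right [simp]: "f \<in> Ar C \<Longrightarrow> Dom C f = A \<Longrightarrow> f \<cdot> ide C A = f"
  using cmp_ide[of f A "Cod C f"] by (auto simp: homset_iff)

lemma cmp_ide_left [simp]: "f \<in> Ar C \<Longrightarrow> Cod C f = A \<Longrightarrow> ide C A \<cdot> f = f"
  using ide_cmp[of f "Dom C f" A] by (auto simp: homset_iff)

lemmas ob_closed [simp] = dom_closed cod_closed

text \<open>Simplification nests composites to the right, so an equation for
  \<open>g \<cdot> f\<close> does not match inside \<open>g \<cdot> (f \<cdot> x)\<close>. This is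
  the form of the equation that applies there.\<close>

lemma cmp_extend:
  assumes "g \<cdot> f = h" "f \<in> Ar C" "g \<in> Ar C" "Cod C f = Dom C g" "x \<in> Ar C" "Cod C x = Dom C f"
  shows "g \<cdot> (f \<cdot> x) = h \<cdot> x"
  using assms assoc[of x f g] by auto

lemma monic_Ar: "monic C m \<Longrightarrow> m \<in> Ar C"
  by (simp add: monic_def)

lemma monic_cancel:
  assumes "monic C m" "m \<cdot> g = m \<cdot> h" "g \<in> Ar C" "h \<in> Ar C"
    "Dom C g = Dom C h" "Cod C g = Dom C m" "Cod C h = Dom C m"
  shows "g = h"
  using assms by (auto simp: monic_def homset_iff)

lemma monicI:
  assumes "m \<in> Ar C"
    and "\<And>g h. g \<in> Ar C \<Longrightarrow> h \<in> Ar C \<Longrightarrow> Dom C g = Dom C h \<Longrightarrow> Cod C g = Dom C m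
      \<Longrightarrow> Cod C h = Dom C m \<Longrightarrow> m \<cdot> g = m \<cdot> h \<Longrightarrow> g = h"
  shows "monic C m"
  using assms by (auto simp: monic_def homset_iff)

lemma monic_cmp:
  assumes "monic C f" "monic C g" "Cod C f = Dom C g"
  shows "monic C (g \<cdot> f)"
proof (rule monicI)
  note [simp] = monic_Ar[OF assms(1)] monic_Ar[OF assms(2)] assms(3)
  show "g \<cdot> f \<in> Ar C" by simp
  fix x y assume [simp]: "x \<in> Ar C" "y \<in> Ar C" and xy: "Dom C x = Dom C y"
    "Cod C x = Dom C (g \<cdot> f)" "Cod C y = Dom C (g \<cdot> f)" and eq: "g \<cdot> f \<cdot> x = g \<cdot> f \<cdot> y"
  have [simp]: "Cod C x = Dom C f" "Cod C y = Dom C f" using xy by simp_all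
  have "f \<cdot> x = f \<cdot> y" using monic_cancel[OF assms(2), of "f \<cdot> x" "f \<cdot> y"] eq xy by simp
  then show "x = y" using monic_cancel[OF assms(1), of x y] xy by simp
qed

lemma monic_right:
  assumes "monic C (g \<cdot> f)" "f \<in> Ar C" "g \<in> Ar C" "Cod C f = Dom C g"
  shows "monic C f"
proof (rule monicI)
  fix x y assume xy: "x \<in> Ar C" "y \<in> Ar C" "Dom C x = Dom C y"
    "Cod C x = Dom C f" "Cod C y = Dom C f" and eq: "f \<cdot> x = f \<cdot> y"
  then have "g \<cdot> f \<cdot> x = g \<cdot> f \<cdot> y" using assms by simp
  then show "x = y" using monic_cancel[OF assms(1), of x y] xy assms by simp
qed (use assms in simp)

lemma monic_ide: "A \<in> Ob C \<Longrightarrow> monic C (ide C A)"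
  by (rule monicI) auto

lemma split_monic:
  assumes "p \<cdot> i = ide C A" "i \<in> homset C A X" "p \<in> homset C X A" "A \<in> Ob C"
  shows "monic C i"
  using monic_right[of p i] monic_ide assms by (auto simp: homset_iff)

lemma kernel_typing:
  assumes "is_kernel C k f"
  shows "f \<in> Ar C" "k \<in> Ar C" "Cod C k = Dom C f" "f \<cdot> k = hzero C (Dom C k) (Cod C f)"
  using assms by (auto simp: is_kernel_def homset_iff)

lemma kernel_factor:
  assumes "is_kernel C k f" "g \<in> Ar C" "Cod C g = Dom C f" "f \<cdot> g = hzero C (Dom C g) (Cod C f)"
  obtains h where "h \<in> Ar C" "Dom C h = Dom C g" "Cod C h = Dom C k" "k \<cdot> h = g"
proof -
  have "g \<in> homset C (Dom C g) (Dom C f)" using assms by (simp add: homset_iff)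
  then have "\<exists>!h. h \<in> homset C (Dom C g) (Dom C k) \<and> k \<cdot> h = g"
    using assms by (simp add: is_kernel_def)
  then show ?thesis using that by (auto simp: homset_iff)
qed

lemma cokernel_typing:
  assumes "is_cokernel C q f"
  shows "f \<in> Ar C" "q \<in> Ar C" "Dom C q = Cod C f" "q \<cdot> f = hzero C (Dom C f) (Cod C q)"
  using assms by (auto simp: is_cokernel_def homset_iff)

lemma cokernel_factor:
  assumes "is_cokernel C q f" "g \<in> Ar C" "Dom C g = Cod C f" "g \<cdot> f = hzero C (Dom C f) (Cod C g)"
  obtains h where "h \<in> Ar C" "Dom C h = Cod C q" "Cod C h = Cod C g" "h \<cdot> q = g"
proof -
  have "g \<in> homset C (Cod C f) (Cod C g)" using assms by (simp add: homset_iff)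
  then have "\<exists>!h. h \<in> homset C (Cod C q) (Cod C g) \<and> h \<cdot> q = g"
    using assms by (simp add: is_cokernel_def)
  then show ?thesis using that by (auto simp: homset_iff)
qed

lemma sub_leI:
  assumes "h \<in> Ar C" "Dom C h = Dom C m" "Cod C h = Dom C n" "n \<cdot> h = m"
  shows "sub_le C m n"
  using assms by (auto simp: sub_le_def homset_iff)

lemma sub_leE:
  assumes "sub_le C m n"
  obtains h where "h \<in> Ar C" "Dom C h = Dom C m" "Cod C h = Dom C n" "n \<cdot> h = m"
  using assms by (auto simp: sub_le_def homset_iff)

lemma sub_le_iff:
  "sub_le C m n \<longleftrightarrow>
    (\<exists>h. h \<in> Ar C \<and> Dom C h = Dom C m \<and> Cod C h = Dom C n \<and> n \<cdot> h = m)"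
  by (auto simp: sub_le_def homset_iff)

lemma fully_invariantE:
  assumes "fully_invariant C k X" "h \<in> homset C X X"
  obtains \<alpha> where "\<alpha> \<in> Ar C" "Dom C \<alpha> = Dom C k" "Cod C \<alpha> = Dom C k" "h \<cdot> k = k \<cdot> \<alpha>"
proof -
  have "\<exists>\<alpha>\<in>homset C (Dom C k) (Dom C k). h \<cdot> k = k \<cdot> \<alpha>"
    using assms unfolding fully_invariant_def by blast
  then show ?thesis using that by (auto simp: homset_iff)
qed

text \<open>The guards \<open>subobject C s X\<close> come from \<open>Lower\<close>, which tests
  only those members of the set that lie in the carrier.\<close>

lemma is_glb_subobjects_iff:
  "is_glb (subobjects C X) l S \<longleftrightarrow>
    subobject C l X \<and> (\<forall>s\<in>S. subobject C s X \<longrightarrow> sub_le C l s) \<and>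
    (\<forall>x. subobject C x X \<longrightarrow> (\<forall>s\<in>S. subobject C s X \<longrightarrow> sub_le C x s) \<longrightarrow> sub_le C x l)"
  by (auto simp: greatest_def Lower_def subobjects_def)

lemma is_lub_subobjects_iff:
  "is_lub (subobjects C X) l S \<longleftrightarrow>
    subobject C l X \<and> (\<forall>s\<in>S. subobject C s X \<longrightarrow> sub_le C s l) \<and>
    (\<forall>x. subobject C x X \<longrightarrow> (\<forall>s\<in>S. subobject C s X \<longrightarrow> sub_le C s x) \<longrightarrow> sub_le C l x)"
  by (auto simp: least_def Upper_def subobjects_def)

end

section \<open>Zero morphisms, kernels and splittings in preadditive categories\<close>

context preadditive_category
begin

lemma hzero_typing [simp]:
  assumes "A \<in> Ob C" "B \<in> Ob C"
  shows "hzero C A B \<in> Ar C" "Dom C (hzero C A B) = A" "Cod C (hzero C A B) = B"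
proof -
  interpret H: comm_group "\<lparr>carrier = homset C A B, mult = hadd C, one = hzero C A B\<rparr>"
    using hom_group[OF assms] .
  show "hzero C A B \<in> Ar C" "Dom C (hzero C A B) = A" "Cod C (hzero C A B) = B"
    using H.one_closed by (auto simp: homset_iff)
qed

text \<open>The record has no symbol for negation; the last clause supplies the difference
  \<open>g - f\<close>, and the one before it is the cancellation by which morphisms are shown to
  vanish.\<close>

lemma hom_group_facts:
  assumes "f \<in> homset C A B" "g \<in> homset C A B"
  shows "hadd C f g \<in> homset C A B"
    and "hadd C f (hzero C A B) = f" "hadd C (hzero C A B) f = f"
    and "hadd C f g = f \<Longrightarrow> g = hzero C A B"
    and "\<exists>h\<in>homset C A B. hadd C f h = g"
proof -
  have "A \<in> Ob C" "B \<in> Ob C" using assms by (auto simp: homset_iff)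
  then interpret H: comm_group "\<lparr>carrier = homset C A B, mult = hadd C, one = hzero C A B\<rparr>"
    by (rule hom_group)
  show "hadd C f g \<in> homset C A B"
    and "hadd C f (hzero C A B) = f" "hadd C (hzero C A B) f = f"
    using assms H.m_closed[of f g] H.r_one[of f] H.l_one[of f] by simp_all
  show "g = hzero C A B" if "hadd C f g = f"
    using that assms H.r_cancel_one'[of f g] H.l_cancel_one[of f g] by simp
  show "\<exists>h\<in>homset C A B. hadd C f h = g"
    using assms H.inv_closed[of f] H.m_closed[of _ g] H.inv_solve_left[of _ f g]
    by (metis monoid.select_convs(1) partial_object.select_convs(1))
qed

text \<open>By distributivity the composite added to itself is itself, so cancellation makes it
  zero.\<close>

lemma cmp_hzero_right [simp]:
  assumes "g \<in> Ar C" "A \<in> Ob C" "Dom C g = B"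
  shows "g \<cdot> hzero C A B = hzero C A (Cod C g)"
proof -
  have B: "B \<in> Ob C" using assms by auto
  have z: "hzero C A B \<in> homset C A B" using assms B by (simp add: homset_iff)
  have g: "g \<in> homset C B (Cod C g)" using assms by (simp add: homset_iff)
  have "hadd C (g \<cdot> hzero C A B) (g \<cdot> hzero C A B) = g \<cdot> hzero C A B"
    using cmp_hadd_right[OF z z g] hom_group_facts(2)[OF z z] by simp
  then show ?thesis using hom_group_facts(4) cmp_closed[OF z g] by metis
qed

lemma cmp_hzero_left [simp]:
  assumes "f \<in> Ar C" "B \<in> Ob C" "Cod C f = A"
  shows "hzero C A B \<cdot> f = hzero C (Dom C f) B"
proof -
  have A: "A \<in> Ob C" using assms by auto
  have z: "hzero C A B \<in> homset C A B" using assms A by (simp add: homset_iff)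
  have f: "f \<in> homset C (Dom C f) A" using assms by (simp add: homset_iff)
  have "hadd C (hzero C A B \<cdot> f) (hzero C A B \<cdot> f) = hzero C A B \<cdot> f"
    using cmp_hadd_left[OF f z z] hom_group_facts(2)[OF z z] by simp
  then show ?thesis using hom_group_facts(4) cmp_closed[OF f z] by metis
qed

text \<open>Two arrows with the same composite with \<open>k\<close> are two factorizations of one
  arrow killed by \<open>f\<close>, and these are unique.\<close>

lemma kernel_monic:
  assumes "is_kernel C k f"
  shows "monic C k"
proof (rule monicI)
  note k [simp] = kernel_typing[OF assms]
  show "k \<in> Ar C" by simp
  fix g h assume [simp]: "g \<in> Ar C" "h \<in> Ar C" and gh: "Dom C g = Dom C h" "Cod C g = Dom C k"
    "Cod C h = Dom C k" and eq: "k \<cdot> g = k \<cdot> h"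
  have "f \<cdot> (k \<cdot> h) = hzero C (Dom C h) (Cod C f)"
    using cmp_extend[OF k(4), of h] gh by simp
  moreover have "k \<cdot> h \<in> homset C (Dom C h) (Dom C f)" using gh by (simp add: homset_iff)
  ultimately have "\<exists>!x. x \<in> homset C (Dom C h) (Dom C k) \<and> k \<cdot> x = k \<cdot> h"
    using assms by (simp add: is_kernel_def)
  then show "g = h" using gh eq by (metis homset_iff \<open>g \<in> Ar C\<close> \<open>h \<in> Ar C\<close>)
qed

lemma cokernel_cancel:
  assumes "is_cokernel C q f" "g \<cdot> q = h \<cdot> q" "g \<in> Ar C" "h \<in> Ar C"
    "Dom C g = Cod C q" "Dom C h = Cod C q" "Cod C g = Cod C h"
  shows "g = h"
proof -
  note q [simp] = cokernel_typing[OF assms(1)]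
  have "h \<cdot> q \<cdot> f = hzero C (Dom C f) (Cod C h)" using assms by simp
  moreover have "h \<cdot> q \<in> homset C (Cod C f) (Cod C h)" using assms by (simp add: homset_iff)
  ultimately have "\<exists>!x. x \<in> homset C (Cod C q) (Cod C h) \<and> x \<cdot> q = h \<cdot> q"
    using assms(1) by (simp add: is_cokernel_def)
  then show ?thesis using assms by (metis homset_iff)
qed

text \<open>Containment in a kernel becomes an equation. In an abelian category every monomorphism
  is a kernel, so this reaches all subobjects; \<open>x\<close> may be any arrow into the domain of
  \<open>f\<close>, monic or not.\<close>

lemma factors_kernel_iff:
  assumes "is_kernel C k f" "x \<in> Ar C" "Cod C x = Dom C f"
  shows "sub_le C x k \<longleftrightarrow> f \<cdot> x = hzero C (Dom C x) (Cod C f)"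
proof
  note k = kernel_typing[OF assms(1)]
  assume "sub_le C x k"
  then obtain h where h: "h \<in> Ar C" "Dom C h = Dom C x" "Cod C h = Dom C k" "k \<cdot> h = x"
    by (rule sub_leE)
  then show "f \<cdot> x = hzero C (Dom C x) (Cod C f)"
    using cmp_extend[OF k(4), of h] k by simp
next
  assume "f \<cdot> x = hzero C (Dom C x) (Cod C f)"
  then show "sub_le C x k"
    using kernel_factor[OF assms] sub_leI by metis
qed

text \<open>Let \<open>u\<close> be the identity minus the idempotent \<open>i \<cdot> p\<close>.
  Then \<open>p \<cdot> u\<close> vanishes, so \<open>u\<close> factors as
  \<open>a \<cdot> b\<close>, and \<open>b\<close> is the second projection. The complement is the
  given kernel \<open>a\<close> and not just some object, which lets later arguments compute with
  it.\<close>

lemma biproduct_complement: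
  assumes i: "i \<in> homset C A X" and p: "p \<in> homset C X A" and pi: "p \<cdot> i = ide C A"
    and a: "is_kernel C a p"
  obtains b where "is_biproduct C X A (Dom C a) i a p b"
proof -
  note k = kernel_typing[OF a]
  have t [simp]: "i \<in> Ar C" "Dom C i = A" "Cod C i = X" "p \<in> Ar C" "Dom C p = X" "Cod C p = A"
    using i p by (auto simp: homset_iff)
  have [simp]: "A \<in> Ob C" "X \<in> Ob C" using ob_closed[of i] by auto
  note [simp] = k[simplified] pi
  have ip: "i \<cdot> p \<in> homset C X X" by (simp add: homset_iff)
  have one: "ide C X \<in> homset C X X" by (simp add: homset_iff)
  obtain u where u: "u \<in> homset C X X" and sum: "hadd C (i \<cdot> p) u = ide C X"
    using hom_group_facts(5)[OF ip one] by blast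
  have [simp]: "u \<in> Ar C" "Dom C u = X" "Cod C u = X" using u by (auto simp: homset_iff)
  have "p \<cdot> (i \<cdot> p) = p" using cmp_extend[OF pi, of p] by simp
  then have "hadd C p (p \<cdot> u) = p"
    using cmp_hadd_right[OF ip u p] sum by simp
  then have pu: "p \<cdot> u = hzero C X A"
    using hom_group_facts(4)[of p X A "p \<cdot> u"] p by (simp add: homset_iff)
  obtain b where b [simp]: "b \<in> Ar C" "Dom C b = X" "Cod C b = Dom C a" and ab: "a \<cdot> b = u"
    using kernel_factor[OF a, of u] pu by auto
  have aX: "a \<in> homset C (Dom C a) X" by (simp add: homset_iff)
  have ua: "u \<cdot> a = a"
    using cmp_hadd_left[OF aX ip u] sum hom_group_facts(3)[of "u \<cdot> a" "Dom C a" X "u \<cdot> a"]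
    by (simp add: homset_iff)
  have ba: "b \<cdot> a = ide C (Dom C a)"
    using monic_cancel[OF kernel_monic[OF a], of "b \<cdot> a" "ide C (Dom C a)"]
      cmp_extend[of a b u a] ab ua assoc[of a b a] by simp
  have "hadd C i (u \<cdot> i) = i"
    using cmp_hadd_left[OF i ip u] sum by simp
  then have ui: "u \<cdot> i = hzero C A X"
    using hom_group_facts(4)[of i A X "u \<cdot> i"] i by (simp add: homset_iff)
  have "a \<cdot> (b \<cdot> i) = hzero C A X"
    using cmp_extend[OF ab, of i] ui by simp
  then have bi: "b \<cdot> i = hzero C A (Dom C a)"
    using monic_cancel[OF kernel_monic[OF a], of "b \<cdot> i" "hzero C A (Dom C a)"] by simp
  have "is_biproduct C X A (Dom C a) i a p b"
    unfolding is_biproduct_def ab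
    by (intro conjI i p aX pi ba bi sum) (simp_all add: homset_iff)
  then show ?thesis by (rule that)
qed

end

section \<open>Intersections of kernels and sums of images, tested on morphisms\<close>

context abelian_category
begin

lemma split_direct_summand:
  assumes "i \<in> homset C A X" "p \<in> homset C X A" "p \<cdot> i = ide C A"
  shows "direct_summand C i X"
proof -
  obtain a where "is_kernel C a p" using ex_kernel assms(2) by (auto simp: homset_iff)
  from biproduct_complement[OF assms this] obtain b where "is_biproduct C X A (Dom C a) i a p b" .
  moreover have "Dom C i = A" using assms(1) by (simp add: homset_iff)
  ultimately show ?thesis unfolding direct_summand_def by blast
qed

lemma monic_is_kernel:
  assumes "monic C x"
  obtains c where "is_kernel C x c"
  using monic_normal[OF assms] by blast

text \<open>Lying below every kernel of \<open>f i\<close> means being killed by \<open>f i\<close>.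
  Since each \<open>f i\<close> has some kernel, no index drops out of the condition.\<close>

lemma is_inter_kernels_iff:
  assumes f: "\<forall>i\<in>I. f i \<in> homset C M N"
  shows "is_inter_kernels C M I f l \<longleftrightarrow> subobject C l M \<and>
    (\<forall>i\<in>I. f i \<cdot> l = hzero C (Dom C l) N) \<and>
    (\<forall>x. subobject C x M \<longrightarrow> (\<forall>i\<in>I. f i \<cdot> x = hzero C (Dom C x) N) \<longrightarrow> sub_le C x l)"
proof -
  have "(\<forall>k\<in>{k. \<exists>i\<in>I. is_kernel C k (f i)}. subobject C k M \<longrightarrow> sub_le C x k) \<longleftrightarrow>
      (\<forall>i\<in>I. f i \<cdot> x = hzero C (Dom C x) N)" (is "?L \<longleftrightarrow> ?R")
    if x: "subobject C x M" for x
  proof -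
    have xM: "x \<in> Ar C" "Cod C x = M" using x by (auto simp: subobject_def monic_Ar)
    have le: "sub_le C x k \<longleftrightarrow> f i \<cdot> x = hzero C (Dom C x) N"
      if "i \<in> I" "is_kernel C k (f i)" for i k
      using factors_kernel_iff[OF that(2)] bspec[OF f that(1)] xM by (simp add: homset_iff)
    have sub: "subobject C k M" if "i \<in> I" "is_kernel C k (f i)" for i k
      using kernel_monic[OF that(2)] kernel_typing[OF that(2)] bspec[OF f that(1)]
      by (simp add: subobject_def homset_iff)
    have ex: "\<exists>k. is_kernel C k (f i)" if "i \<in> I" for i
      using ex_kernel bspec[OF f that] by (simp add: homset_iff)
    show ?thesis using le sub ex by blast
  qed
  then show ?thesis unfolding is_inter_kernels_def is_glb_subobjects_iff by blast
qed

text \<open>Write \<open>x\<close> as the kernel of \<open>c\<close>. If \<open>c\<close> kills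
  \<open>m\<close> it kills \<open>f\<close>, which factors through \<open>m\<close>; if
  \<open>c\<close> kills \<open>f\<close> it factors through the cokernel \<open>q\<close> of
  \<open>f\<close>, which kills \<open>m\<close>.\<close>

lemma image_sub_le_iff:
  assumes "is_image C m f" "monic C x" "Cod C x = Cod C f"
  shows "sub_le C m x \<longleftrightarrow> sub_le C f x"
proof -
  obtain q where q: "is_cokernel C q f" and m: "is_kernel C m q"
    using assms(1) by (auto simp: is_image_def)
  obtain c where c: "is_kernel C x c" using assms(2) by (rule monic_is_kernel)
  note [simp] = cokernel_typing[OF q] kernel_typing(1-3)[OF m] kernel_typing(1-3)[OF c] assms(3)
  have [simp]: "Dom C c = Cod C f" using kernel_typing(3)[OF c] assms(3) by metis
  have "c \<cdot> m = hzero C (Dom C m) (Cod C c) \<longleftrightarrow> c \<cdot> f = hzero C (Dom C f) (Cod C c)"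
  proof
    assume cm: "c \<cdot> m = hzero C (Dom C m) (Cod C c)"
    obtain u where "u \<in> Ar C" "Dom C u = Dom C f" "Cod C u = Dom C m" "m \<cdot> u = f"
      using kernel_factor[OF m, of f] by auto
    then show "c \<cdot> f = hzero C (Dom C f) (Cod C c)"
      using cmp_extend[OF cm, of u] by simp
  next
    assume "c \<cdot> f = hzero C (Dom C f) (Cod C c)"
    then obtain d where d: "d \<in> Ar C" "Dom C d = Cod C q" "Cod C d = Cod C c" "d \<cdot> q = c"
      using cokernel_factor[OF q, of c] by auto
    then show "c \<cdot> m = hzero C (Dom C m) (Cod C c)"
      using assoc[of m q d] kernel_typing(4)[OF m] by simp
  qed
  then show ?thesis using factors_kernel_iff[OF c, of m] factors_kernel_iff[OF c, of f] by simp
qed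

text \<open>Images are eliminated: a subobject contains the image of \<open>f i\<close> exactly when
  \<open>f i\<close> factors through it. Here \<open>sub_le\<close> is applied to arrows that need
  not be monic.\<close>

lemma is_sum_images_iff:
  assumes f: "\<forall>i\<in>I. f i \<in> homset C M N"
  shows "is_sum_images C N I f l \<longleftrightarrow> subobject C l N \<and> (\<forall>i\<in>I. sub_le C (f i) l) \<and>
    (\<forall>x. subobject C x N \<longrightarrow> (\<forall>i\<in>I. sub_le C (f i) x) \<longrightarrow> sub_le C l x)"
proof -
  have "(\<forall>m\<in>{m. \<exists>i\<in>I. is_image C m (f i)}. subobject C m N \<longrightarrow> sub_le C m x) \<longleftrightarrow>
      (\<forall>i\<in>I. sub_le C (f i) x)"
    if x: "subobject C x N" for x
  proof -
    have le: "sub_le C m x \<longleftrightarrow> sub_le C (f i) x" if "i \<in> I" "is_image C m (f i)" for i m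
      using image_sub_le_iff[OF that(2), of x] bspec[OF f that(1)] x
      by (simp add: subobject_def homset_iff)
    have sub: "subobject C m N" if "i \<in> I" "is_image C m (f i)" for i m
    proof -
      from that(2) obtain q where q: "is_cokernel C q (f i)" "is_kernel C m q"
        by (auto simp: is_image_def)
      show ?thesis
        using kernel_monic[OF q(2)] kernel_typing[OF q(2)] cokernel_typing[OF q(1)] bspec[OF f \<open>i \<in> I\<close>]
        by (simp add: subobject_def homset_iff)
    qed
    have ex: "\<exists>m. is_image C m (f i)" if i: "i \<in> I" for i
    proof -
      obtain q where q: "is_cokernel C q (f i)"
        using ex_cokernel bspec[OF f i] by (auto simp: homset_iff)
      then obtain m where "is_kernel C m q" using ex_kernel cokernel_typing(2) by blast
      with q show ?thesis by (auto simp: is_image_def)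
    qed
    show ?thesis using le sub ex by blast
  qed
  then show ?thesis unfolding is_sum_images_def is_lub_subobjects_iff by blast
qed

section \<open>Decomposing morphisms along a biproduct\<close>

lemma biproduct_typing:
  assumes "is_biproduct C X A B i j p q"
  shows "i \<in> Ar C" "Dom C i = A" "Cod C i = X" "j \<in> Ar C" "Dom C j = B" "Cod C j = X"
    "p \<in> Ar C" "Dom C p = X" "Cod C p = A" "q \<in> Ar C" "Dom C q = X" "Cod C q = B"
    "X \<in> Ob C" "A \<in> Ob C" "B \<in> Ob C"
  using assms by (auto simp: is_biproduct_def homset_iff)

lemma biproduct_eqs:
  assumes "is_biproduct C X A B i j p q"
  shows "p \<cdot> i = ide C A" "q \<cdot> j = ide C B" "p \<cdot> j = hzero C B A" "q \<cdot> i = hzero C A B"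
    "hadd C (i \<cdot> p) (j \<cdot> q) = ide C X"
  using assms by (auto simp: is_biproduct_def)

text \<open>Compose \<open>i \<cdot> p + j \<cdot> q = 1\<close> with \<open>x\<close>; the second
  summand vanishes. So an arrow killed by \<open>q\<close> factors through \<open>i\<close>.\<close>

lemma biproduct_split_left:
  assumes "is_biproduct C X A B i j p q" "x \<in> Ar C" "Cod C x = X"
    and "q \<cdot> x = hzero C (Dom C x) B"
  shows "i \<cdot> (p \<cdot> x) = x"
proof -
  note [simp] = biproduct_typing[OF assms(1)] assms(2-)
  have "hadd C (i \<cdot> p \<cdot> x) (j \<cdot> q \<cdot> x) = x"
    using cmp_hadd_left[of x "Dom C x" X "i \<cdot> p" X "j \<cdot> q"] biproduct_eqs[OF assms(1)]
    by (simp add: homset_iff)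
  then show ?thesis
    using hom_group_facts(2)[of "i \<cdot> (p \<cdot> x)" "Dom C x" X "i \<cdot> (p \<cdot> x)"]
    by (simp add: homset_iff)
qed

text \<open>The dual computation: \<open>d\<close> kills the summand \<open>B\<close>, hence it is
  determined by its restriction to \<open>A\<close>.\<close>

lemma biproduct_split_right:
  assumes "is_biproduct C X A B i j p q" "d \<in> Ar C" "Dom C d = X"
    and "d \<cdot> j = hzero C B (Cod C d)"
  shows "d \<cdot> (i \<cdot> p) = d"
proof -
  note [simp] = biproduct_typing[OF assms(1)] assms(2-)
  have "d \<cdot> (j \<cdot> q) = hzero C X (Cod C d)"
    using cmp_extend[OF assms(4), of q] by simp
  then have "hadd C (d \<cdot> (i \<cdot> p)) (hzero C X (Cod C d)) = d"
    using cmp_hadd_right[of "i \<cdot> p" X X "j \<cdot> q" d "Cod C d"] biproduct_eqs[OF assms(1)]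
    by (simp add: homset_iff)
  then show ?thesis
    using hom_group_facts(2)[of "d \<cdot> (i \<cdot> p)" X "Cod C d" "d \<cdot> (i \<cdot> p)"]
    by (simp add: homset_iff)
qed

section \<open>Intersections of kernels under passage to direct summands\<close>

lemma inter_kernels_summand:
  assumes bip: "is_biproduct C M M' B m j p q"
    and n: "n \<in> homset C N' N" "monic C n"
    and f: "\<forall>i\<in>I. f i \<in> homset C M' N'"
    and l: "is_inter_kernels C M I (\<lambda>i. n \<cdot> (f i \<cdot> p)) l"
    and k: "direct_summand C k M"
    and lk: "essential_in C l k"
  obtains l' k' where "is_inter_kernels C M' I f l'" "direct_summand C k' M'"
    "essential_in C l' k'" "fully_invariant C k M \<Longrightarrow> fully_invariant C k' M'"
proof -
  note [simp] = biproduct_typing[OF bip]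
  note eqs = biproduct_eqs[OF bip]
  have [simp]: "n \<in> Ar C" "Dom C n = N'" "Cod C n = N" "N' \<in> Ob C" "N \<in> Ob C"
    using n(1) by (auto simp: homset_iff)
  have ft [simp]: "f i \<in> Ar C" "Dom C (f i) = M'" "Cod C (f i) = N'" if "i \<in> I" for i
    using bspec[OF f that] by (auto simp: homset_iff)
  have gt: "\<forall>i\<in>I. n \<cdot> (f i \<cdot> p) \<in> homset C M N"
    by (simp add: homset_iff)
  have mm: "monic C m"
    using split_monic[OF eqs(1), of M] by (simp add: homset_iff)
  have mj: "monic C j"
    using split_monic[OF eqs(2), of M] by (simp add: homset_iff)
  note lchar = l[unfolded is_inter_kernels_iff[OF gt]]
  have lmon: "monic C l" and [simp]: "l \<in> Ar C" "Cod C l = M"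
    using lchar by (auto simp: subobject_def monic_Ar)
  obtain B' j1 t q1 where kbip: "is_biproduct C M (Dom C k) B' k j1 t q1"
    using k by (auto simp: direct_summand_def)
  note [simp] = biproduct_typing(1,3-)[OF kbip]
  note tk = biproduct_eqs(1)[OF kbip]
  have kmon: "monic C k"
    using split_monic[OF tk, of M] by (simp add: homset_iff)
  obtain e where ess: "essential C e (Dom C k)" and lke: "l = k \<cdot> e"
    using lk by (auto simp: essential_in_def)
  have emon: "monic C e" and [simp]: "e \<in> Ar C" "Cod C e = Dom C k"
    using ess by (auto simp: essential_def subobject_def monic_Ar)
  have [simp]: "Dom C l = Dom C e" using lke by simp

  \<comment> \<open>Since \<open>p \<cdot> j\<close> is zero, every extended morphism kills
    \<open>B\<close>. Hence \<open>B\<close> lies in \<open>L\<close>, and through \<open>e\<close>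
    also in \<open>K\<close>.\<close>
  have "\<forall>i\<in>I. n \<cdot> (f i \<cdot> p) \<cdot> j = hzero C (Dom C j) N"
    by (simp add: eqs)
  then have "sub_le C j l"
    using lchar mj by (simp add: subobject_def)
  then obtain j' where [simp]: "j' \<in> Ar C" "Dom C j' = B" "Cod C j' = Dom C e" and j': "l \<cdot> j' = j"
    by (auto simp: sub_le_iff)
  have kej: "k \<cdot> (e \<cdot> j') = j" using j' lke by simp

  obtain a where a: "is_kernel C a (q \<cdot> k)" using ex_kernel[of "q \<cdot> k"] by auto
  note [simp] = kernel_typing(2,3)[OF a, simplified]
  have qka: "q \<cdot> (k \<cdot> a) = hzero C (Dom C a) B" using kernel_typing(4)[OF a] by simp
  have amon: "monic C a" using a by (rule kernel_monic)
  have "q \<cdot> k \<cdot> (e \<cdot> j') = ide C B" using kej eqs by simp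
  then obtain b where abip: "is_biproduct C (Dom C k) B (Dom C a) (e \<cdot> j') a (q \<cdot> k) b"
    using biproduct_complement[of "e \<cdot> j'" B "Dom C k" "q \<cdot> k" a] a by (auto simp: homset_iff)
  note [simp] = biproduct_typing(10-12)[OF abip]
  have ba: "b \<cdot> a = ide C (Dom C a)" using biproduct_eqs(2)[OF abip] .
  \<comment> \<open>\<open>K \<inter> M'\<close> is the kernel \<open>a\<close> of \<open>q \<cdot> k\<close>, which is split by the inclusion of \<open>B\<close> into \<open>K\<close>.\<close>
  define k' where "k' = p \<cdot> (k \<cdot> a)"
  have [simp]: "k' \<in> Ar C" "Dom C k' = Dom C a" "Cod C k' = M'" by (simp_all add: k'_def)
  \<comment> \<open>\<open>q\<close> kills \<open>k \<cdot> a\<close>, so this arrow lands in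
    \<open>M'\<close> and composing it with \<open>p\<close> loses nothing.\<close>
  have mk': "m \<cdot> k' = k \<cdot> a"
    unfolding k'_def by (rule biproduct_split_left[OF bip]) (simp_all add: qka)
  \<comment> \<open>The retraction of \<open>k'\<close> embeds \<open>M'\<close> in
    \<open>M\<close>, projects onto \<open>K\<close> by \<open>t\<close> and then onto the kernel by
    \<open>b\<close>.\<close>
  have "b \<cdot> (t \<cdot> m) \<cdot> k' = ide C (Dom C a)"
    using mk' cmp_extend[OF tk, of a] ba by simp
  then have k'sum: "direct_summand C k' M'"
    using split_direct_summand[of k' "Dom C a" M' "b \<cdot> (t \<cdot> m)"] by (simp add: homset_iff)
  have k'mon: "monic C k'"
    using monic_right[of m k'] monic_cmp[OF amon kmon] mk' by simp

  \<comment> \<open>In the same way \<open>L \<inter> M'\<close> is the kernel of \<open>q\<close>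
    restricted to \<open>L\<close>, and \<open>l'\<close> is its inclusion in
    \<open>M'\<close>.\<close>
  obtain a' where a': "is_kernel C a' (q \<cdot> l)" using ex_kernel[of "q \<cdot> l"] by auto
  note [simp] = kernel_typing(2,3)[OF a', simplified]
  have qla: "q \<cdot> (l \<cdot> a') = hzero C (Dom C a') B" using kernel_typing(4)[OF a'] by simp
  have a'mon: "monic C a'" using a' by (rule kernel_monic)
  define l' where "l' = p \<cdot> (l \<cdot> a')"
  have [simp]: "l' \<in> Ar C" "Dom C l' = Dom C a'" "Cod C l' = M'" by (simp_all add: l'_def)
  have ml': "m \<cdot> l' = l \<cdot> a'"
    unfolding l'_def by (rule biproduct_split_left[OF bip]) (simp_all add: qla)
  have l'mon: "monic C l'"
    using monic_right[of m l'] monic_cmp[OF a'mon lmon] ml' by simp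

  have glb: "is_inter_kernels C M' I f l'"
    unfolding is_inter_kernels_iff[OF f]
  proof (intro conjI ballI allI impI)
    show "subobject C l' M'" by (simp add: subobject_def l'mon)
  next
    fix i assume i: "i \<in> I"
    then have gl: "n \<cdot> (f i \<cdot> p) \<cdot> l = hzero C (Dom C l) N" using lchar by blast
    have "n \<cdot> (f i \<cdot> l') = hzero C (Dom C l') N"
      using cmp_extend[OF gl, of a'] i by (simp add: l'_def)
    then show "f i \<cdot> l' = hzero C (Dom C l') N'"
      using monic_cancel[OF n(2), of "f i \<cdot> l'" "hzero C (Dom C l') N'"] i by simp
  next
    fix x assume x: "subobject C x M'" and fx: "\<forall>i\<in>I. f i \<cdot> x = hzero C (Dom C x) N'"
    have xmon: "monic C x" and [simp]: "x \<in> Ar C" "Cod C x = M'"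
      using x by (auto simp: subobject_def monic_Ar)
    have pmx: "p \<cdot> (m \<cdot> x) = x" using cmp_extend[OF eqs(1), of x] by simp
    have qmx: "q \<cdot> (m \<cdot> x) = hzero C (Dom C x) B" using cmp_extend[OF eqs(4), of x] by simp
    \<comment> \<open>Seen in \<open>M\<close>, the subobject \<open>x\<close> lies in
      \<open>L\<close>; as \<open>q\<close> also kills it, it lies in
      \<open>L \<inter> M'\<close>.\<close>
    have "\<forall>i\<in>I. n \<cdot> (f i \<cdot> p) \<cdot> (m \<cdot> x) = hzero C (Dom C (m \<cdot> x)) N"
      using fx by (simp add: pmx)
    then have "sub_le C (m \<cdot> x) l"
      using lchar monic_cmp[OF xmon mm] by (simp add: subobject_def)
    then obtain y where [simp]: "y \<in> Ar C" "Dom C y = Dom C x" "Cod C y = Dom C e"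
      and y: "l \<cdot> y = m \<cdot> x"
      by (auto simp: sub_le_iff)
    obtain z where [simp]: "z \<in> Ar C" "Dom C z = Dom C x" "Cod C z = Dom C a'" and z: "a' \<cdot> z = y"
      using kernel_factor[OF a', of y] qmx y by auto
    have "l' \<cdot> z = x" by (simp add: l'_def z y pmx)
    then show "sub_le C x l'" by (intro sub_leI[of z]) simp_all
  qed

  \<comment> \<open>The composite \<open>e \<cdot> a'\<close> includes \<open>L \<inter> M'\<close>
    in \<open>K\<close>. It factors through \<open>K \<inter> M'\<close>, and the factor
    \<open>e'\<close> is the inclusion to be proved essential.\<close>
  have "q \<cdot> k \<cdot> (e \<cdot> a') = hzero C (Dom C a') B" using qla lke by simp
  then obtain e' where [simp]: "e' \<in> Ar C" "Dom C e' = Dom C a'" "Cod C e' = Dom C a"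
    and e': "a \<cdot> e' = e \<cdot> a'"
    using kernel_factor[OF a, of "e \<cdot> a'"] by auto
  have l'k': "l' = k' \<cdot> e'"
    by (simp add: l'_def k'_def e' lke)
  have e'mon: "monic C e'"
    using monic_right[of k' e'] l'mon l'k' by simp
  have "essential C e' (Dom C k')"
    unfolding essential_def
  proof (intro conjI allI impI)
    show "subobject C e' (Dom C k')" by (simp add: subobject_def e'mon)
  next
    fix x z assume A: "subobject C x (Dom C k') \<and>
      is_glb (subobjects C (Dom C k')) z {e', x} \<and> zero_object C (Dom C z)"
    have xmon: "monic C x" and [simp]: "x \<in> Ar C" "Cod C x = Dom C a"
      using A by (auto simp: subobject_def monic_Ar)
    note zg = conjunct1[OF conjunct2[OF A], unfolded is_glb_subobjects_iff]
    have zmon: "monic C z" and [simp]: "z \<in> Ar C" "Cod C z = Dom C a"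
      using zg by (auto simp: subobject_def monic_Ar)
    have "sub_le C z e'" "sub_le C z x"
      using zg e'mon xmon by (auto simp: subobject_def)
    then obtain z1 z2 where [simp]: "z1 \<in> Ar C" "Dom C z1 = Dom C z" "Cod C z1 = Dom C a'"
        "z2 \<in> Ar C" "Dom C z2 = Dom C z" "Cod C z2 = Dom C x"
      and z1: "e' \<cdot> z1 = z" and z2: "x \<cdot> z2 = z"
      by (auto simp: sub_le_iff)
    \<comment> \<open>A subobject of \<open>K \<inter> M'\<close> meets \<open>L\<close> only inside
      \<open>L \<inter> M'\<close>, so its intersection with \<open>L\<close> formed in
      \<open>K\<close> is still \<open>z\<close>. The essentiality of \<open>e\<close> then applies
      to \<open>a \<cdot> x\<close>.\<close>
    have "is_glb (subobjects C (Dom C k)) (a \<cdot> z) {e, a \<cdot> x}"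
      unfolding is_glb_subobjects_iff
    proof (intro conjI allI impI)
      show "subobject C (a \<cdot> z) (Dom C k)"
        using monic_cmp[OF zmon amon] by (simp add: subobject_def)
      have "e \<cdot> (a' \<cdot> z1) = a \<cdot> z"
        using cmp_extend[OF e', of z1] z1 by simp
      then have "sub_le C (a \<cdot> z) e" by (intro sub_leI[of "a' \<cdot> z1"]) simp_all
      moreover have "sub_le C (a \<cdot> z) (a \<cdot> x)" by (intro sub_leI[of z2]) (simp_all add: z2)
      ultimately show "\<forall>s\<in>{e, a \<cdot> x}. subobject C s (Dom C k) \<longrightarrow> sub_le C (a \<cdot> z) s" by simp
    next
      fix w assume w: "subobject C w (Dom C k)"
        and "\<forall>s\<in>{e, a \<cdot> x}. subobject C s (Dom C k) \<longrightarrow> sub_le C w s"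
      then have we: "sub_le C w e" and wax: "sub_le C w (a \<cdot> x)"
        using emon monic_cmp[OF xmon amon] by (auto simp: subobject_def)
      from we obtain u where [simp]: "u \<in> Ar C" "Dom C u = Dom C w" "Cod C u = Dom C e"
        and u: "e \<cdot> u = w"
        by (rule sub_leE)
      from wax obtain v where [simp]: "v \<in> Ar C" "Dom C v = Dom C w"
        and v': "Cod C v = Dom C (a \<cdot> x)" "a \<cdot> x \<cdot> v = w"
        by (rule sub_leE)
      have [simp]: "Cod C v = Dom C x" using v' by simp
      have v: "a \<cdot> (x \<cdot> v) = w" using v' by simp
      have wmon: "monic C w" and [simp]: "w \<in> Ar C" "Cod C w = Dom C k"
        using w by (auto simp: subobject_def monic_Ar)
      \<comment> \<open>\<open>w\<close> factors through \<open>a\<close>, hence lies in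
        \<open>M'\<close>. So its factor \<open>u\<close> through \<open>L\<close> passes through
        the kernel \<open>a'\<close>.\<close>
      have "q \<cdot> (k \<cdot> (a \<cdot> (x \<cdot> v))) = hzero C (Dom C w) B"
        using cmp_extend[OF qka, of "x \<cdot> v"] by simp
      then have "q \<cdot> l \<cdot> u = hzero C (Dom C w) B" using u v lke by simp
      then obtain u' where [simp]: "u' \<in> Ar C" "Dom C u' = Dom C w" "Cod C u' = Dom C a'"
        and u': "a' \<cdot> u' = u"
        using kernel_factor[OF a', of u] by auto
      have "a \<cdot> (e' \<cdot> u') = w"
        using cmp_extend[OF e', of u'] u' u by simp
      then have eu: "e' \<cdot> u' = x \<cdot> v"
        using monic_cancel[OF amon, of "e' \<cdot> u'" "x \<cdot> v"] v by simp
      have "monic C (x \<cdot> v)"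
        using monic_right[of a "x \<cdot> v"] v wmon by simp
      moreover have "sub_le C (x \<cdot> v) e'" by (intro sub_leI[of u']) (simp_all add: eu)
      moreover have "sub_le C (x \<cdot> v) x" by (intro sub_leI[of v]) simp_all
      ultimately have "sub_le C (x \<cdot> v) z" using zg by (simp add: subobject_def)
      then obtain s where [simp]: "s \<in> Ar C" "Dom C s = Dom C w" "Cod C s = Dom C z"
        and s: "z \<cdot> s = x \<cdot> v"
        by (auto simp: sub_le_iff)
      show "sub_le C w (a \<cdot> z)" by (intro sub_leI[of s]) (simp_all add: s v)
    qed
    moreover have "subobject C (a \<cdot> x) (Dom C k)"
      using monic_cmp[OF xmon amon] by (simp add: subobject_def)
    moreover have "zero_object C (Dom C (a \<cdot> z))" using A by simp
    ultimately have "zero_object C (Dom C (a \<cdot> x))"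
      using ess unfolding essential_def by blast
    then show "zero_object C (Dom C x)" by simp
  qed
  then have ess': "essential_in C l' k'"
    unfolding essential_in_def using l'k' by blast

  \<comment> \<open>Kept as an implication, so that one lemma serves both the plain and the strong
    version.\<close>
  have inv: "fully_invariant C k' M'" if fi: "fully_invariant C k M"
    unfolding fully_invariant_def
  proof (intro conjI ballI)
    show "subobject C k' M'" by (simp add: subobject_def k'mon)
  next
    fix h assume "h \<in> homset C M' M'"
    then have [simp]: "h \<in> Ar C" "Dom C h = M'" "Cod C h = M'" by (auto simp: homset_iff)
    have "m \<cdot> (h \<cdot> p) \<in> homset C M M" by (simp add: homset_iff)
    with fi obtain \<alpha> where [simp]: "\<alpha> \<in> Ar C" "Dom C \<alpha> = Dom C k" "Cod C \<alpha> = Dom C k"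
      and \<alpha>: "m \<cdot> (h \<cdot> p) \<cdot> k = k \<cdot> \<alpha>"
      by (rule fully_invariantE)
    have ka: "k \<cdot> (\<alpha> \<cdot> a) = m \<cdot> (h \<cdot> k')"
      using cmp_extend[OF \<alpha>[symmetric], of a] by (simp add: k'_def)
    \<comment> \<open>On \<open>K \<inter> M'\<close> the extended endomorphism takes values in
      \<open>M'\<close>, where \<open>q\<close> vanishes. Therefore \<open>\<alpha>\<close>
      restricts to \<open>K \<inter> M'\<close>.\<close>
    then have "q \<cdot> k \<cdot> (\<alpha> \<cdot> a) = hzero C (Dom C a) B"
      using cmp_extend[OF eqs(4), of "h \<cdot> k'"] by simp
    then obtain \<beta> where [simp]: "\<beta> \<in> Ar C" "Dom C \<beta> = Dom C a" "Cod C \<beta> = Dom C a"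
      and \<beta>: "a \<cdot> \<beta> = \<alpha> \<cdot> a"
      using kernel_factor[OF a, of "\<alpha> \<cdot> a"] by auto
    have "m \<cdot> (k' \<cdot> \<beta>) = m \<cdot> (h \<cdot> k')"
      using cmp_extend[OF mk', of \<beta>] \<beta> ka by simp
    then have "h \<cdot> k' = k' \<cdot> \<beta>"
      using monic_cancel[OF mm, of "k' \<cdot> \<beta>" "h \<cdot> k'"] by simp
    then show "\<exists>\<alpha>\<in>homset C (Dom C k') (Dom C k'). h \<cdot> k' = k' \<cdot> \<alpha>"
      by (intro bexI[of _ \<beta>]) (simp_all add: homset_iff)
  qed
  show ?thesis using glb k'sum ess' inv by (rule that)
qed

section \<open>Sums of images under passage to direct summands\<close>

lemma sum_images_summand:
  assumes bip: "is_biproduct C N N' B n j r q"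
    and m: "m \<in> homset C M' M" and p: "p \<in> homset C M M'" and pm: "p \<cdot> m = ide C M'"
    and f: "\<forall>i\<in>I. f i \<in> homset C M' N'"
    and l: "is_sum_images C N I (\<lambda>i. n \<cdot> (f i \<cdot> p)) l"
    and k: "direct_summand C k N"
    and lk: "lies_above C l k"
  obtains l' k' where "is_sum_images C N' I f l'" "direct_summand C k' N'"
    "lies_above C l' k'" "fully_invariant C k N \<Longrightarrow> fully_invariant C k' N'"
proof -
  note [simp] = biproduct_typing[OF bip]
  note eqs = biproduct_eqs[OF bip]
  have [simp]: "m \<in> Ar C" "Dom C m = M'" "Cod C m = M" "p \<in> Ar C" "Dom C p = M" "Cod C p = M'"
    "M \<in> Ob C" "M' \<in> Ob C"
    using m p by (auto simp: homset_iff)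
  have ft [simp]: "f i \<in> Ar C" "Dom C (f i) = M'" "Cod C (f i) = N'" if "i \<in> I" for i
    using bspec[OF f that] by (auto simp: homset_iff)
  have gt: "\<forall>i\<in>I. n \<cdot> (f i \<cdot> p) \<in> homset C M N"
    by (simp add: homset_iff)
  have nmon: "monic C n"
    using split_monic[OF eqs(1), of N] by (simp add: homset_iff)
  note lchar = l[unfolded is_sum_images_iff[OF gt]]
  have lmon: "monic C l" and [simp]: "l \<in> Ar C" "Cod C l = N"
    using lchar by (auto simp: subobject_def monic_Ar)
  obtain B' j1 t q1 where kbip: "is_biproduct C N (Dom C k) B' k j1 t q1"
    using k by (auto simp: direct_summand_def)
  note [simp] = biproduct_typing(1,3-)[OF kbip]
  note tk = biproduct_eqs(1)[OF kbip]
  obtain e q0 p0 s where [simp]: "e \<in> Ar C" "Dom C e = Dom C k" "Cod C e = Dom C l"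
    and le: "l \<cdot> e = k" and q0: "is_cokernel C q0 e" and p0: "is_cokernel C p0 k"
    and [simp]: "s \<in> Ar C" "Dom C s = Cod C q0" "Cod C s = Cod C p0"
    and sq: "s \<cdot> q0 = p0 \<cdot> l" and sup: "superfluous C s (Cod C p0)"
    using lk unfolding lies_above_def Bex_def homset_iff by blast
  have smon: "monic C s" using sup by (simp add: superfluous_def subobject_def)
  note [simp] = cokernel_typing(2,3)[OF q0, simplified] cokernel_typing(2,3)[OF p0, simplified]
  have p0k: "p0 \<cdot> k = hzero C (Dom C k) (Cod C p0)" using cokernel_typing(4)[OF p0] .

  \<comment> \<open>All extended morphisms factor through \<open>n\<close>, so their sum
    \<open>L\<close> lies in \<open>N'\<close>; \<open>l'\<close> is its inclusion there.\<close>
  have "\<forall>i\<in>I. sub_le C (n \<cdot> (f i \<cdot> p)) n"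
  proof
    fix i assume "i \<in> I"
    then show "sub_le C (n \<cdot> (f i \<cdot> p)) n" by (intro sub_leI[of "f i \<cdot> p"]) simp_all
  qed
  then have "sub_le C l n"
    using lchar nmon by (simp add: subobject_def)
  then obtain l' where [simp]: "l' \<in> Ar C" "Dom C l' = Dom C l" "Cod C l' = N'" and nl': "n \<cdot> l' = l"
    by (auto simp: sub_le_iff)
  have l'mon: "monic C l'"
    using monic_right[of n l'] lmon nl' by simp

  have lub: "is_sum_images C N' I f l'"
    unfolding is_sum_images_iff[OF f]
  proof (intro conjI ballI allI impI)
    show "subobject C l' N'" by (simp add: subobject_def l'mon)
  next
    fix i assume i: "i \<in> I"
    then have "sub_le C (n \<cdot> (f i \<cdot> p)) l" using lchar by blast
    then obtain u where [simp]: "u \<in> Ar C" "Dom C u = M" "Cod C u = Dom C l"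
      and u: "l \<cdot> u = n \<cdot> (f i \<cdot> p)"
      using i by (auto simp: sub_le_iff)
    \<comment> \<open>Composing with \<open>m\<close> undoes the extension, because
      \<open>p \<cdot> m\<close> is the identity.\<close>
    have "n \<cdot> (l' \<cdot> (u \<cdot> m)) = n \<cdot> f i"
      using cmp_extend[OF nl', of "u \<cdot> m"] cmp_extend[OF u, of m] i pm by simp
    then have "l' \<cdot> (u \<cdot> m) = f i"
      using monic_cancel[OF nmon, of "l' \<cdot> (u \<cdot> m)" "f i"] i by simp
    then show "sub_le C (f i) l'"
      using i by (intro sub_leI[of "u \<cdot> m"]) simp_all
  next
    fix x assume x: "subobject C x N'" and fx: "\<forall>i\<in>I. sub_le C (f i) x"
    have xmon: "monic C x" and [simp]: "x \<in> Ar C" "Cod C x = N'"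
      using x by (auto simp: subobject_def monic_Ar)
    have "\<forall>i\<in>I. sub_le C (n \<cdot> (f i \<cdot> p)) (n \<cdot> x)"
    proof
      fix i assume i: "i \<in> I"
      then have "sub_le C (f i) x" using fx by blast
      then obtain v where [simp]: "v \<in> Ar C" "Dom C v = M'" "Cod C v = Dom C x" and v: "x \<cdot> v = f i"
        using i by (auto simp: sub_le_iff)
      have "x \<cdot> (v \<cdot> p) = f i \<cdot> p" using cmp_extend[OF v, of p] by simp
      then show "sub_le C (n \<cdot> (f i \<cdot> p)) (n \<cdot> x)"
        using i by (intro sub_leI[of "v \<cdot> p"]) simp_all
    qed
    then have "sub_le C l (n \<cdot> x)"
      using lchar monic_cmp[OF xmon nmon] by (simp add: subobject_def)
    then obtain w where [simp]: "w \<in> Ar C" "Dom C w = Dom C l"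
      and w': "Cod C w = Dom C (n \<cdot> x)" "n \<cdot> x \<cdot> w = l"
      by (rule sub_leE)
    have [simp]: "Cod C w = Dom C x" using w' by simp
    have w: "n \<cdot> (x \<cdot> w) = l" using w' by simp
    have "x \<cdot> w = l'"
      using monic_cancel[OF nmon, of "x \<cdot> w" l'] w nl' by simp
    then show "sub_le C l' x" by (intro sub_leI[of w]) simp_all
  qed

  \<comment> \<open>\<open>K\<close> lies in \<open>L\<close> and thus in \<open>N'\<close>. Since
    \<open>e\<close> is unchanged, \<open>q0\<close> remains the projection onto
    \<open>L/K\<close>.\<close>
  define k' where "k' = l' \<cdot> e"
  have [simp]: "k' \<in> Ar C" "Dom C k' = Dom C k" "Cod C k' = N'" by (simp_all add: k'_def)
  have nk': "n \<cdot> k' = k"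
    unfolding k'_def using cmp_extend[OF nl', of e] le by simp
  have rk: "r \<cdot> k = k'"
    using cmp_extend[OF eqs(1), of k'] nk' by simp
  have "t \<cdot> n \<cdot> k' = ide C (Dom C k)" using nk' tk by simp
  then have k'sum: "direct_summand C k' N'" and k'mon: "monic C k'"
    using split_direct_summand[of k' "Dom C k" N' "t \<cdot> n"] split_monic[of "t \<cdot> n" k' "Dom C k" N']
    by (simp_all add: homset_iff)

  have inv: "fully_invariant C k' N'" if fi: "fully_invariant C k N"
    unfolding fully_invariant_def
  proof (intro conjI ballI)
    show "subobject C k' N'" by (simp add: subobject_def k'mon)
  next
    fix h assume "h \<in> homset C N' N'"
    then have [simp]: "h \<in> Ar C" "Dom C h = N'" "Cod C h = N'" by (auto simp: homset_iff)
    have "n \<cdot> (h \<cdot> r) \<in> homset C N N" by (simp add: homset_iff)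
    with fi obtain \<alpha> where [simp]: "\<alpha> \<in> Ar C" "Dom C \<alpha> = Dom C k" "Cod C \<alpha> = Dom C k"
      and \<alpha>: "n \<cdot> (h \<cdot> r) \<cdot> k = k \<cdot> \<alpha>"
      by (rule fully_invariantE)
    have "n \<cdot> (h \<cdot> k') = n \<cdot> (k' \<cdot> \<alpha>)"
      using cmp_extend[OF nk', of \<alpha>] \<alpha> rk by simp
    then have "h \<cdot> k' = k' \<cdot> \<alpha>"
      using monic_cancel[OF nmon, of "h \<cdot> k'" "k' \<cdot> \<alpha>"] by simp
    then show "\<exists>\<alpha>\<in>homset C (Dom C k') (Dom C k'). h \<cdot> k' = k' \<cdot> \<alpha>"
      by (intro bexI[of _ \<alpha>]) (simp_all add: homset_iff)
  qed

  obtain p' where p': "is_cokernel C p' k'" using ex_cokernel[of k'] by auto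
  note [simp] = cokernel_typing(2,3)[OF p', simplified]
  have p'k': "p' \<cdot> k' = hzero C (Dom C k) (Cod C p')" using cokernel_typing(4)[OF p'] by simp
  have "p' \<cdot> l' \<cdot> e = hzero C (Dom C k) (Cod C p')" using p'k' by (simp add: k'_def)
  then obtain s' where [simp]: "s' \<in> Ar C" "Dom C s' = Cod C q0" "Cod C s' = Cod C p'"
    and s': "s' \<cdot> q0 = p' \<cdot> l'"
    using cokernel_factor[OF q0, of "p' \<cdot> l'"] by auto
  \<comment> \<open>\<open>n\<close> and \<open>r\<close> induce \<open>n1\<close> and
    \<open>r1\<close> between \<open>N'/K\<close> and \<open>N/K\<close>. As
    \<open>r1 \<cdot> n1\<close> is the identity, \<open>N'/K\<close> is a summand of
    \<open>N/K\<close>, with complement the kernel \<open>c1\<close> of \<open>r1\<close>.\<close>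
  have "p0 \<cdot> n \<cdot> k' = hzero C (Dom C k) (Cod C p0)" using nk' p0k by simp
  then obtain n1 where [simp]: "n1 \<in> Ar C" "Dom C n1 = Cod C p'" "Cod C n1 = Cod C p0"
    and n1: "n1 \<cdot> p' = p0 \<cdot> n"
    using cokernel_factor[OF p', of "p0 \<cdot> n"] by auto
  have "p' \<cdot> r \<cdot> k = hzero C (Dom C k) (Cod C p')" using rk p'k' by simp
  then obtain r1 where [simp]: "r1 \<in> Ar C" "Dom C r1 = Cod C p0" "Cod C r1 = Cod C p'"
    and r1: "r1 \<cdot> p0 = p' \<cdot> r"
    using cokernel_factor[OF p0, of "p' \<cdot> r"] by auto
  have "r1 \<cdot> n1 \<cdot> p' = ide C (Cod C p') \<cdot> p'"
    using n1 cmp_extend[OF r1, of n] eqs by simp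
  then have rn: "r1 \<cdot> n1 = ide C (Cod C p')"
    using cokernel_cancel[OF p', of "r1 \<cdot> n1" "ide C (Cod C p')"] by simp
  have "n1 \<cdot> s' \<cdot> q0 = s \<cdot> q0"
    using s' cmp_extend[OF n1, of l'] nl' sq by simp
  then have ns: "n1 \<cdot> s' = s"
    using cokernel_cancel[OF q0, of "n1 \<cdot> s'" s] by simp
  have s'mon: "monic C s'"
    using monic_right[of n1 s'] smon ns by simp
  obtain c1 where c1: "is_kernel C c1 r1" using ex_kernel[of r1] by auto
  note [simp] = kernel_typing(2,3)[OF c1, simplified]
  have rc: "r1 \<cdot> c1 = hzero C (Dom C c1) (Cod C p')" using kernel_typing(4)[OF c1] by simp
  obtain b1 where qbip: "is_biproduct C (Cod C p0) (Cod C p') (Dom C c1) n1 c1 r1 b1"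
    using biproduct_complement[OF _ _ rn c1] by (auto simp: homset_iff)

  have "superfluous C s' (Cod C p')"
    unfolding superfluous_def
  proof (intro conjI allI impI)
    show "subobject C s' (Cod C p')" by (simp add: subobject_def s'mon)
  next
    fix x assume A: "subobject C x (Cod C p') \<and>
      is_lub (subobjects C (Cod C p')) (ide C (Cod C p')) {s', x}"
    have xmon: "monic C x" and [simp]: "x \<in> Ar C" "Cod C x = Cod C p'"
      using A by (auto simp: subobject_def monic_Ar)
    note xlub = conjunct2[OF A, unfolded is_lub_subobjects_iff]
    obtain c where c: "is_kernel C x c" using xmon by (rule monic_is_kernel)
    have [simp]: "c \<in> Ar C" "Dom C c = Cod C p'"
      using kernel_typing[OF c] by simp_all
    have cx: "c \<cdot> x = hzero C (Dom C x) (Cod C c)" using kernel_typing(4)[OF c] .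
    \<comment> \<open>With \<open>x\<close> the kernel of \<open>c\<close>, the preimage of
      \<open>x\<close> under \<open>r1\<close> is the kernel of \<open>c \<cdot> r1\<close>.\<close>
    obtain y where y: "is_kernel C y (c \<cdot> r1)" using ex_kernel[of "c \<cdot> r1"] by auto
    note [simp] = kernel_typing(2,3)[OF y, simplified]
    have ymon: "monic C y" using y by (rule kernel_monic)
    have "c \<cdot> r1 \<cdot> (n1 \<cdot> x) = hzero C (Dom C x) (Cod C c)"
      using cmp_extend[OF rn, of x] cx by simp
    then obtain x1 where [simp]: "x1 \<in> Ar C" "Dom C x1 = Dom C x" "Cod C x1 = Dom C y"
      and x1: "y \<cdot> x1 = n1 \<cdot> x"
      using kernel_factor[OF y, of "n1 \<cdot> x"] by auto
    have "c \<cdot> r1 \<cdot> c1 = hzero C (Dom C c1) (Cod C c)" using rc by simp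
    then obtain c2 where [simp]: "c2 \<in> Ar C" "Dom C c2 = Dom C c1" "Cod C c2 = Dom C y"
      and c2: "y \<cdot> c2 = c1"
      using kernel_factor[OF y, of c1] by auto
    \<comment> \<open>\<open>y\<close> is the preimage of \<open>x\<close> in \<open>N/K\<close>; it contains \<open>x\<close> and the complement of \<open>N'/K\<close>.\<close>
    have "is_lub (subobjects C (Cod C p0)) (ide C (Cod C p0)) {s, y}"
      unfolding is_lub_subobjects_iff
    proof (intro conjI ballI allI impI)
      show "subobject C (ide C (Cod C p0)) (Cod C p0)" by (simp add: subobject_def monic_ide)
      fix z assume "z \<in> {s, y}" "subobject C z (Cod C p0)"
      then show "sub_le C z (ide C (Cod C p0))"
        by (intro sub_leI[of z]) (auto simp: subobject_def monic_Ar)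
    next
      fix w assume w: "subobject C w (Cod C p0)"
        and ub: "\<forall>z\<in>{s, y}. subobject C z (Cod C p0) \<longrightarrow> sub_le C z w"
      have wmon: "monic C w" and [simp]: "w \<in> Ar C" "Cod C w = Cod C p0"
        using w by (auto simp: subobject_def monic_Ar)
      \<comment> \<open>It suffices that \<open>d\<close> vanishes. It kills \<open>y\<close> and so
        the complement \<open>c1\<close>, hence it is determined by \<open>d \<cdot> n1\<close>.
        That arrow kills \<open>s'\<close> and \<open>x\<close>, whose sum is all of
        \<open>N'/K\<close>.\<close>
      obtain d where d: "is_kernel C w d" using wmon by (rule monic_is_kernel)
      have [simp]: "d \<in> Ar C" "Dom C d = Cod C p0"
        using kernel_typing[OF d] by simp_all
      have "sub_le C s w" "sub_le C y w"
        using ub smon ymon by (auto simp: subobject_def)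
      then have ds: "d \<cdot> s = hzero C (Dom C s) (Cod C d)" and dy: "d \<cdot> y = hzero C (Dom C y) (Cod C d)"
        using factors_kernel_iff[OF d, of s] factors_kernel_iff[OF d, of y] by simp_all
      have "d \<cdot> c1 = hzero C (Dom C c1) (Cod C d)"
        using cmp_extend[OF dy, of c2] c2 by simp
      then have dnr: "d \<cdot> (n1 \<cdot> r1) = d"
        by (intro biproduct_split_right[OF qbip]) simp_all
      obtain w' where w': "is_kernel C w' (d \<cdot> n1)" using ex_kernel[of "d \<cdot> n1"] by auto
      note [simp] = kernel_typing(2,3)[OF w', simplified]
      have "d \<cdot> n1 \<cdot> s' = hzero C (Dom C s') (Cod C d)" using ns ds by simp
      then have "sub_le C s' w'" using factors_kernel_iff[OF w', of s'] by simp
      moreover have "d \<cdot> n1 \<cdot> x = hzero C (Dom C x) (Cod C d)"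
        using cmp_extend[OF dy, of x1] x1 by simp
      then have "sub_le C x w'" using factors_kernel_iff[OF w', of x] by simp
      ultimately have "sub_le C (ide C (Cod C p')) w'"
        using xlub kernel_monic[OF w'] by (simp add: subobject_def)
      then have dn: "d \<cdot> n1 = hzero C (Cod C p') (Cod C d)"
        using factors_kernel_iff[OF w', of "ide C (Cod C p')"] by simp
      then have "d = hzero C (Cod C p0) (Cod C d)"
        using cmp_extend[OF dn, of r1] dnr by simp
      then show "sub_le C (ide C (Cod C p0)) w"
        using factors_kernel_iff[OF d, of "ide C (Cod C p0)"] by simp
    qed
    moreover have "subobject C y (Cod C p0)" using ymon by (simp add: subobject_def)
    ultimately have "y .=\<^bsub>subobjects C (Cod C p0)\<^esub> ide C (Cod C p0)"
      using sup unfolding superfluous_def by blast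
    then have "sub_le C (ide C (Cod C p0)) y" by (simp add: subobjects_def)
    then have cr: "c \<cdot> r1 = hzero C (Cod C p0) (Cod C c)"
      using factors_kernel_iff[OF y, of "ide C (Cod C p0)"] by simp
    \<comment> \<open>\<open>r1\<close> has the section \<open>n1\<close>, so \<open>c\<close>
      vanishes together with \<open>c \<cdot> r1\<close>, and its kernel \<open>x\<close> is
      everything.\<close>
    have "c = hzero C (Cod C p') (Cod C c)"
      using assoc[of n1 r1 c] rn cr by simp
    then have "sub_le C (ide C (Cod C p')) x"
      using factors_kernel_iff[OF c, of "ide C (Cod C p')"] by simp
    moreover have "sub_le C x (ide C (Cod C p'))" by (intro sub_leI[of x]) simp_all
    ultimately show "x .=\<^bsub>subobjects C (Cod C p')\<^esub> ide C (Cod C p')"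
      by (simp add: subobjects_def)
  qed
  then have above: "lies_above C l' k'"
    unfolding lies_above_def
    by (intro bexI[of _ e] conjI exI[of _ q0] exI[of _ p'] bexI[of _ s'])
      (simp_all add: homset_iff k'_def[symmetric] q0 p' s')
  show ?thesis using lub k'sum above inv by (rule that)
qed

end

section \<open>The plain and strong versions of both statements\<close>

theorem corollary8p2:
  fixes C :: "('o, 'a) cat" and M N M' N' :: 'o and m n :: 'a
  assumes "abelian_category C"
    and "M \<in> Ob C" and "N \<in> Ob C"
    and "m \<in> homset C M' M" and "direct_summand C m M"
    and "n \<in> homset C N' N" and "direct_summand C n N"
  shows "(AB3_star TYPE('i) C \<longrightarrow>
      (cs_baer TYPE('i) C M N \<longrightarrow> cs_baer TYPE('i) C M' N') \<and>
      (strongly_cs_baer TYPE('i) C M N \<longrightarrow> strongly_cs_baer TYPE('i) C M' N')) \<and>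
    (AB3 TYPE('i) C \<longrightarrow>
      (dual_cs_baer TYPE('i) C M N \<longrightarrow> dual_cs_baer TYPE('i) C M' N') \<and>
      (dual_strongly_cs_baer TYPE('i) C M N \<longrightarrow> dual_strongly_cs_baer TYPE('i) C M' N'))"
proof -
  interpret abelian_category C by fact
  obtain B j p q where mb: "is_biproduct C M M' B m j p q"
    using assms(4,5) by (auto simp: direct_summand_def homset_iff)
  obtain D j' r q' where nb: "is_biproduct C N N' D n j' r q'"
    using assms(6,7) by (auto simp: direct_summand_def homset_iff)
  have p: "p \<in> homset C M M'" and pm: "p \<cdot>\<^bsub>C\<^esub> m = ide C M'"
    using mb by (auto simp: is_biproduct_def)
  have nmon: "monic C n"
    using split_monic[of r n N' N] nb biproduct_typing(14)[OF nb] by (auto simp: is_biproduct_def)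
  \<comment> \<open>All four implications apply the hypothesis to this extension of the family, over
    the same index set.\<close>
  have g: "n \<cdot>\<^bsub>C\<^esub> (f \<cdot>\<^bsub>C\<^esub> p) \<in> homset C M N" if "f \<in> homset C M' N'" for f
    using that p assms(6) cmp_closed by blast
  note inter = inter_kernels_summand[OF mb assms(6) nmon]
  note sums = sum_images_summand[OF nb assms(4) p pm]
  have "cs_baer TYPE('i) C M' N'" if H: "cs_baer TYPE('i) C M N"
    unfolding cs_baer_def
  proof (intro allI impI)
    fix I :: "'i set" and f assume f: "\<forall>i\<in>I. f i \<in> homset C M' N'"
    then have "\<forall>i\<in>I. n \<cdot>\<^bsub>C\<^esub> (f i \<cdot>\<^bsub>C\<^esub> p) \<in> homset C M N" using g by blast
    then obtain l k where "is_inter_kernels C M I (\<lambda>i. n \<cdot>\<^bsub>C\<^esub> (f i \<cdot>\<^bsub>C\<^esub> p)) l"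
      "direct_summand C k M" "essential_in C l k"
      using H[unfolded cs_baer_def, rule_format, of I "\<lambda>i. n \<cdot>\<^bsub>C\<^esub> (f i \<cdot>\<^bsub>C\<^esub> p)"] by blast
    from inter[OF f this] show "\<exists>l k. is_inter_kernels C M' I f l \<and>
      direct_summand C k M' \<and> essential_in C l k" by blast
  qed
  moreover have "strongly_cs_baer TYPE('i) C M' N'" if H: "strongly_cs_baer TYPE('i) C M N"
    unfolding strongly_cs_baer_def
  proof (intro allI impI)
    fix I :: "'i set" and f assume f: "\<forall>i\<in>I. f i \<in> homset C M' N'"
    then have "\<forall>i\<in>I. n \<cdot>\<^bsub>C\<^esub> (f i \<cdot>\<^bsub>C\<^esub> p) \<in> homset C M N" using g by blast
    then obtain l k where lk: "is_inter_kernels C M I (\<lambda>i. n \<cdot>\<^bsub>C\<^esub> (f i \<cdot>\<^bsub>C\<^esub> p)) l"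
      "direct_summand C k M" "essential_in C l k" and inv: "fully_invariant C k M"
      using H[unfolded strongly_cs_baer_def, rule_format, of I "\<lambda>i. n \<cdot>\<^bsub>C\<^esub> (f i \<cdot>\<^bsub>C\<^esub> p)"] by blast
    from inter[OF f lk] inv show "\<exists>l k. is_inter_kernels C M' I f l \<and>
      direct_summand C k M' \<and> fully_invariant C k M' \<and> essential_in C l k" by metis
  qed
  moreover have "dual_cs_baer TYPE('i) C M' N'" if H: "dual_cs_baer TYPE('i) C M N"
    unfolding dual_cs_baer_def
  proof (intro allI impI)
    fix I :: "'i set" and f assume f: "\<forall>i\<in>I. f i \<in> homset C M' N'"
    then have "\<forall>i\<in>I. n \<cdot>\<^bsub>C\<^esub> (f i \<cdot>\<^bsub>C\<^esub> p) \<in> homset C M N" using g by blast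
    then obtain l k where "is_sum_images C N I (\<lambda>i. n \<cdot>\<^bsub>C\<^esub> (f i \<cdot>\<^bsub>C\<^esub> p)) l"
      "direct_summand C k N" "lies_above C l k"
      using H[unfolded dual_cs_baer_def, rule_format, of I "\<lambda>i. n \<cdot>\<^bsub>C\<^esub> (f i \<cdot>\<^bsub>C\<^esub> p)"] by blast
    from sums[OF f this] show "\<exists>l k. is_sum_images C N' I f l \<and>
      direct_summand C k N' \<and> lies_above C l k" by blast
  qed
  moreover have "dual_strongly_cs_baer TYPE('i) C M' N'" if H: "dual_strongly_cs_baer TYPE('i) C M N"
    unfolding dual_strongly_cs_baer_def
  proof (intro allI impI)
    fix I :: "'i set" and f assume f: "\<forall>i\<in>I. f i \<in> homset C M' N'"
    then have "\<forall>i\<in>I. n \<cdot>\<^bsub>C\<^esub> (f i \<cdot>\<^bsub>C\<^esub> p) \<in> homset C M N" using g by blast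
    then obtain l k where lk: "is_sum_images C N I (\<lambda>i. n \<cdot>\<^bsub>C\<^esub> (f i \<cdot>\<^bsub>C\<^esub> p)) l"
      "direct_summand C k N" "lies_above C l k" and inv: "fully_invariant C k N"
      using H[unfolded dual_strongly_cs_baer_def, rule_format, of I "\<lambda>i. n \<cdot>\<^bsub>C\<^esub> (f i \<cdot>\<^bsub>C\<^esub> p)"] by blast
    from sums[OF f lk] inv show "\<exists>l k. is_sum_images C N' I f l \<and>
      direct_summand C k N' \<and> fully_invariant C k N' \<and> lies_above C l k" by metis
  qed
  ultimately show ?thesis by blast
qed

end
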